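(* For any positive integers $k,n$, if $A\subseteq V(C_k^{\boxtimes n})$ is non-empty and has size $|A|=\alpha k^n$, then $$\bigl|N_{C_k^{\boxtimes n}}[A]\bigr|\ \ge\ k^n\cdot\min_{t\in\{1,\dots,n\}}\Bigl\{1,\ \bigl(\alpha^{1/t}+2/k\bigr)^t,\ 1-\bigl(\max\{0,(1-\alpha)^{1/t}-2/k\}\bigr)^t\Bigr\}.$$
   Context: $C_k$ denotes the cycle graph on $k$ vertices: vertex set $\mathbb Z/k\mathbb Z$, with distinct $u,v$ adjacent iff $u-v=\pm1$ (so $C_1$ is a single vertex and $C_2$ a single edge). For graphs $G_1,\dots,G_n$, the strong product $G_1\boxtimes\dots\boxtimes G_n$ has vertex set $V(G_1)\times\dots\times V(G_n)$, and distinct vertices $(v_1,\dots,v_n)$ and $(u_1,\dots,u_n)$ are adjacent whenever, for each $i$, either $v_i=u_i$ or $v_iu_i$ is an edge of $G_i$. $G^{\boxtimes n}$ is the $n$-fold strong product of $G$ with itself. $N_G[A]$ is the closed neighborhood of $A\subseteq V(G)$: all vertices in $A$ or adjacent to some vertex in $A$. *)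

theory Defs
  imports "Graph_Theory.Pair_Digraph" "HOL-Library.FuncSet" "HOL-Number_Theory.Cong" Complex_Main
begin

text \<open>Finite simple graphs are those of the locale \<^locale>\<open>pair_graph\<close>:
  loop-free finite digraphs with a symmetric arc set.\<close>

definition cycle_graph :: "nat \<Rightarrow> int pair_pre_digraph" where
  "cycle_graph k =
    \<lparr> pverts = {0..<int k},
      parcs = {(u, v). u \<in> {0..<int k} \<and> v \<in> {0..<int k} \<and> u \<noteq> v \<and>
                 ([u - v = 1] (mod int k) \<or> [u - v = -1] (mod int k))} \<rparr>"

text \<open>The vertices of a product of \<open>n\<close> graphs are the extensional functions on \<open>{1..n}\<close>, that is,
  those with value \<^const>\<open>undefined\<close> outside \<open>{1..n}\<close>, so that each tuple is represented
  exactly once.\<close>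

definition strong_product :: "nat \<Rightarrow> (nat \<Rightarrow> 'a pair_pre_digraph) \<Rightarrow> (nat \<Rightarrow> 'a) pair_pre_digraph" where
  "strong_product n G =
    (let V = Pi\<^sub>E {1..n} (\<lambda>i. pverts (G i)) in
      \<lparr> pverts = V,
        parcs = {(u, v). u \<in> V \<and> v \<in> V \<and> u \<noteq> v \<and>
                   (\<forall>i\<in>{1..n}. u i = v i \<or> (u i, v i) \<in> parcs (G i))} \<rparr>)"

definition strong_power :: "'a pair_pre_digraph \<Rightarrow> nat \<Rightarrow> (nat \<Rightarrow> 'a) pair_pre_digraph" where
  "strong_power G n = strong_product n (\<lambda>_. G)"

definition closed_neighborhood :: "'a pair_pre_digraph \<Rightarrow> 'a set \<Rightarrow> 'a set" where
  "closed_neighborhood G A = {v \<in> pverts G. v \<in> A \<or> (\<exists>u\<in>A. (u, v) \<in> parcs G)}"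

lemma pair_graph_cycle_graph: "pair_graph (cycle_graph k)"
proof
  show "symmetric (with_proj (cycle_graph k))"
  proof -
    have "sym (parcs (cycle_graph k))"
    proof (rule symI)
      fix u v assume uv: "(u, v) \<in> parcs (cycle_graph k)"
      have "[v - u = - c] (mod int k)" if "[u - v = c] (mod int k)" for c
        using that cong_minus_minus_iff[of "u - v" c "int k"] by simp
      from this[of 1] this[of "-1"] uv show "(v, u) \<in> parcs (cycle_graph k)"
        by (auto simp: cycle_graph_def)
    qed
    thus ?thesis
      by (simp add: symmetric_def)
  qed
qed (auto simp: cycle_graph_def intro: finite_subset[of _ "{0..<int k} \<times> {0..<int k}"])

lemma pair_graph_strong_product:
  assumes "\<And>i. i \<in> {1..n} \<Longrightarrow> pair_graph (G i)"
  shows "pair_graph (strong_product n G)"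
proof -
  define V where "V = Pi\<^sub>E {1..n} (\<lambda>i. pverts (G i))"
  have fin: "finite V"
    unfolding V_def
  proof (rule finite_PiE)
    fix i assume "i \<in> {1..n}"
    then interpret pair_graph "G i" by (rule assms)
    show "finite (pverts (G i))" by (rule pair_finite_verts)
  qed simp
  have s: "(y, x) \<in> parcs (G i)" if i: "Suc 0 \<le> i" "i \<le> n" and xy: "(x, y) \<in> parcs (G i)" for i x y
  proof -
    interpret pair_graph "G i" using i by (intro assms) simp
    show ?thesis using pair_sym_arcs xy by (auto simp: symmetric_def dest: symD)
  qed
  have "sym (parcs (strong_product n G))"
    by (rule symI) (fastforce simp: strong_product_def Let_def dest: s)
  then have sym: "symmetric (with_proj (strong_product n G))"
    by (simp add: symmetric_def)
  show ?thesis
    by unfold_locales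
      (use fin sym in \<open>auto simp: strong_product_def Let_def V_def
         intro: finite_subset[of _ "V \<times> V"]\<close>)
qed

lemma pair_graph_strong_power: "pair_graph G \<Longrightarrow> pair_graph (strong_power G n)"
  unfolding strong_power_def by (rule pair_graph_strong_product)

end

theory Submission
  imports Defs "HOL-Analysis.Convex"
begin

text \<open>
  Scale the torus to volume 1, so that passing to the closed neighbourhood lengthens every
  coordinate interval by \<open>e = 2 / k\<close>.  The right-hand side is then the least volume
  reached by thickening one of the model sets of volume \<open>\<alpha>\<close>: the products of a cube of
  dimension \<open>t\<close> with a subtorus, whose volume becomes \<^term>\<open>(\<alpha> powr (1 / real t) + e) ^ t\<close>, and the
  complements of such products.  Call this minimum the profile of dimension \<open>n\<close>.

  The inequality follows by induction on \<open>n\<close>, slicing along the last coordinate.  The slice of the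
  neighbourhood at \<open>y\<close> contains the neighbourhoods of the slices of \<open>A\<close> at \<open>y - 1\<close>, \<open>y\<close>
  and \<open>y + 1\<close>.  With the induction hypothesis, everything reduces to a statement about a
  function on one cycle, the density of the slices (\<open>cycle_profile_ge\<close>).  On a cycle,
  taking maxima over closed neighbourhoods gains at least two copies of the largest value at the
  cost of the two smallest ones (\<open>cycle_sum_ge\<close>).

  The profile is concave on \<^term>\<open>{0..1::real}\<close>, because each of its pieces is.  A chord therefore
  replaces the densities by two levels \<open>m \<le> M\<close>.  Sliding these two levels apart while the mean is
  fixed, concavity again leaves only three configurations: constant densities, lower level \<open>0\<close>,
  and upper level \<open>1\<close> (\<open>profile_two_level\<close>).  The last two are
  the product of an interval with a model set, or the complement of such a product, and these are
  compared with the models of one dimension more.  For interval times cube this is the arithmetic-geometric mean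
  inequality (\<open>cube_growth_product\<close>).  The difficult case is interval times complement of a cube,
  where the interval or the square is at least as good (\<open>mixed_product\<close>).  The configurations with upper
  level \<open>1\<close> are the complements of those with lower level \<open>0\<close>, and the Galois connection between
  thickening a set and thickening its complement (\<open>cube_shrink_le_iff\<close>) transfers the results.
\<close>

section \<open>Growing and shrinking cubes\<close>

lemma powr_inverse_power:
  fixes x :: real
  assumes "x \<ge> 0" "t \<ge> 1"
  shows "(x powr (1 / real t)) ^ t = x"
  using assms by (cases "x = 0") (auto simp: powr_power)

lemma power_powr_inverse:
  fixes x :: real
  assumes "x \<ge> 0" "t \<ge> 1"
  shows "(x ^ t) powr (1 / real t) = x"
proof -
  have "((x ^ t) powr (1 / real t)) ^ t = x ^ t"
    using assms by (intro powr_inverse_power) auto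
  then show ?thesis
    using assms power_eq_iff_eq_base[of t "(x ^ t) powr (1 / real t)" x] by auto
qed

text \<open>The volume of a \<open>t\<close>-dimensional cube of volume \<open>y\<close> after its side has grown by \<open>e\<close>.\<close>

definition cube_growth :: "real \<Rightarrow> nat \<Rightarrow> real \<Rightarrow> real" where
  "cube_growth e t y = (y powr (1 / real t) + e) ^ t"

text \<open>The volume that remains of a \<open>t\<close>-dimensional cubical hole of volume \<open>b\<close> when the set around it is
  thickened; the hole closes up once its side is at most \<open>e\<close>.\<close>

definition cube_shrink :: "real \<Rightarrow> nat \<Rightarrow> real \<Rightarrow> real" where
  "cube_shrink e t b = (max 0 (b powr (1 / real t) - e)) ^ t"

lemma cube_shrink_nonneg: "cube_shrink e t b \<ge> 0"
  by (simp add: cube_shrink_def)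

lemma cube_growth_nonneg: "e \<ge> 0 \<Longrightarrow> cube_growth e t y \<ge> 0"
  by (simp add: cube_growth_def)

text \<open>Both sides compare the sides of the cubes.  This adjunction turns every
  upper bound on grown cubes into a bound on shrunk holes, so that concavity and the product
  inequality need a direct proof only for growth.\<close>

lemma cube_shrink_le_iff:
  assumes "e \<ge> 0" "t \<ge> 1" "y \<ge> 0" "b \<ge> 0"
  shows "cube_shrink e t b \<le> y \<longleftrightarrow> b \<le> cube_growth e t y"
proof -
  let ?b = "b powr (1 / real t)" and ?y = "y powr (1 / real t)"
  have "cube_shrink e t b \<le> y \<longleftrightarrow> (max 0 (?b - e)) ^ t \<le> ?y ^ t"
    using assms by (simp add: cube_shrink_def powr_inverse_power)
  also have "\<dots> \<longleftrightarrow> max 0 (?b - e) \<le> ?y"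
    using assms by (intro power_mono_iff) auto
  also have "\<dots> \<longleftrightarrow> ?b \<le> ?y + e"
    by auto
  also have "\<dots> \<longleftrightarrow> ?b ^ t \<le> (?y + e) ^ t"
    using assms by (intro power_mono_iff[symmetric]) auto
  also have "\<dots> \<longleftrightarrow> b \<le> cube_growth e t y"
    using assms by (simp add: cube_growth_def powr_inverse_power)
  finally show ?thesis .
qed

lemma cube_shrink_cube_growth:
  assumes "e \<ge> 0" "t \<ge> 1" "y \<ge> 0"
  shows "cube_shrink e t (cube_growth e t y) = y"
  using assms by (simp add: cube_shrink_def cube_growth_def power_powr_inverse powr_inverse_power)

lemma cube_growth_mono:
  assumes "e \<ge> 0" "0 \<le> x" "x \<le> y"
  shows "cube_growth e t x \<le> cube_growth e t y"
  using assms unfolding cube_growth_def by (intro power_mono add_mono powr_mono2) auto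

lemma cube_shrink_mono:
  assumes "0 \<le> x" "x \<le> y"
  shows "cube_shrink e t x \<le> cube_shrink e t y"
  using assms unfolding cube_shrink_def
  by (intro power_mono max.mono diff_mono powr_mono2) auto

lemma le_cube_shrink:
  assumes "e \<ge> 0" "t \<ge> 1" "y \<ge> 0" "cube_growth e t y \<le> b"
  shows "y \<le> cube_shrink e t b"
  using cube_shrink_mono[OF cube_growth_nonneg assms(4), of e t] cube_shrink_cube_growth[OF assms(1-3)]
    assms by simp

text \<open>The tangent line of the concave function \<open>x powr p\<close> at \<open>z\<close>, as an instance of Young's inequality.\<close>

lemma powr_le_tangent:
  fixes x z p :: real
  assumes "x \<ge> 0" "z > 0" "0 < p" "p \<le> 1"
  shows "x powr p \<le> z powr p * (1 - p + p * (x / z))"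
proof (cases "x = 0")
  case False
  have "1 powr (1 - p) * (x / z) powr p \<le> (1 - p) * 1 + p * (x / z)"
    using assms False by (intro Youngs_inequality_0) auto
  moreover have "(x / z) powr p = x powr p / z powr p"
    using assms by (simp add: powr_divide)
  ultimately show ?thesis
    using assms by (simp add: pos_divide_le_eq mult.commute)
qed (use assms in auto)

text \<open>Averaging the tangent at the mean gives concavity up to and including the endpoint \<open>0\<close>,
  where a derivative is not available.\<close>

lemma concave_on_powr:
  fixes p :: real
  assumes "0 < p" "p \<le> 1"
  shows "concave_on {0..} (\<lambda>x. x powr p)"
  unfolding concave_on_iff
proof (intro conjI ballI allI impI)
  fix x y u v :: real
  assume "x \<in> {0..}" "y \<in> {0..}" and uv: "0 \<le> u" "0 \<le> v" "u + v = 1"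
  then have xy: "x \<ge> 0" "y \<ge> 0"
    by auto
  define z where "z = u * x + v * y"
  have "u * x powr p + v * y powr p \<le> z powr p"
  proof (cases "z = 0")
    case True
    then have "u * x = 0" "v * y = 0"
      using xy uv by (auto simp: z_def add_nonneg_eq_0_iff)
    then show ?thesis
      by auto
  next
    case False
    then have z: "z > 0"
      using xy uv by (simp add: z_def order_less_le)
    have "u * x powr p + v * y powr p
        \<le> u * (z powr p * (1 - p + p * (x / z))) + v * (z powr p * (1 - p + p * (y / z)))"
      using powr_le_tangent[OF xy(1) z assms] powr_le_tangent[OF xy(2) z assms] uv
      by (intro add_mono mult_left_mono) auto
    also have "\<dots> = z powr p * ((u + v) * (1 - p) + p * ((u * x + v * y) / z))"
      by (simp add: algebra_simps add_divide_distrib)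
    also have "\<dots> = z powr p"
      using z uv(3) by (simp add: z_def[symmetric])
    finally show ?thesis .
  qed
  then show "u * x powr p + v * y powr p \<le> (u *\<^sub>R x + v *\<^sub>R y) powr p"
    by (simp add: z_def)
qed auto

lemma concave_on_sum_fun:
  assumes "finite I" "convex S" "\<And>i. i \<in> I \<Longrightarrow> concave_on S (f i)"
  shows "concave_on S (\<lambda>x. \<Sum>i\<in>I. f i x)"
  using assms(1,3) by (induction I rule: finite_induct) (auto simp: concave_on_const assms(2) intro!: concave_on_add)

text \<open>The binomial expansion writes the growth as a combination, with nonnegative coefficients, of the
  powers \<open>y powr (i / t)\<close>, whose exponents lie between \<open>0\<close> and \<open>1\<close>.\<close>

lemma concave_on_cube_growth:
  assumes "e \<ge> 0" "t \<ge> 1"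
  shows "concave_on {0..} (cube_growth e t)"
proof -
  have "cube_growth e t = (\<lambda>y. \<Sum>i\<le>t. (real (t choose i) * e ^ (t - i)) * (y powr (1 / real t)) ^ i)"
    by (auto simp: cube_growth_def binomial_ring mult_ac)
  moreover have "concave_on {0..} (\<lambda>y::real. (y powr (1 / real t)) ^ i)" if "i \<le> t" for i
  proof (cases "i = 0")
    case False
    have "(\<lambda>y::real. (y powr (1 / real t)) ^ i) = (\<lambda>y. y powr (real i / real t))"
    proof
      fix y :: real
      show "(y powr (1 / real t)) ^ i = y powr (real i / real t)"
        using False by (cases "y = 0") (auto simp: powr_power)
    qed
    then show ?thesis
      using False that assms concave_on_powr[of "real i / real t"] by simp
  qed (simp add: concave_on_const)
  ultimately show ?thesis
    using assms by (auto intro!: concave_on_sum_fun concave_on_cmul)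
qed

text \<open>The shrunk volume is the least \<open>y\<close> that grows to at least \<open>b\<close>, and such an inverse of a
  concave increasing function is convex.\<close>

lemma convex_on_cube_shrink:
  assumes "e \<ge> 0" "t \<ge> 1"
  shows "convex_on {0..} (cube_shrink e t)"
  unfolding convex_on_def
proof (intro conjI ballI allI impI)
  fix x y u v :: real
  assume "x \<in> {0..}" "y \<in> {0..}" and uv: "0 \<le> u" "0 \<le> v" "u + v = 1"
  then have xy: "x \<ge> 0" "y \<ge> 0"
    by auto
  let ?K = "cube_shrink e t" and ?F = "cube_growth e t"
  have "u * x + v * y \<le> u * ?F (?K x) + v * ?F (?K y)"
    using cube_shrink_le_iff[OF assms cube_shrink_nonneg xy(1), of e t]
      cube_shrink_le_iff[OF assms cube_shrink_nonneg xy(2), of e t] uv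
    by (intro add_mono mult_left_mono) auto
  also have "\<dots> \<le> ?F (u * ?K x + v * ?K y)"
    using concave_on_cube_growth[OF assms] uv cube_shrink_nonneg by (auto simp: concave_on_iff)
  finally have "?K (u * x + v * y) \<le> u * ?K x + v * ?K y"
    using xy uv assms cube_shrink_nonneg by (subst cube_shrink_le_iff) auto
  then show "?K (u *\<^sub>R x + v *\<^sub>R y) \<le> u * ?K x + v * ?K y"
    by simp
qed auto

lemma weighted_mean_power_ge:
  fixes p q :: real
  assumes "p \<ge> 0" "q \<ge> 0"
  shows "p * q ^ t \<le> ((p + real t * q) / real (Suc t)) ^ Suc t"
proof (cases "p = 0 \<or> q = 0")
  case False
  let ?u = "1 / real (Suc t)" and ?v = "real t / real (Suc t)"
  have "p powr ?u * q powr ?v \<le> ?u * p + ?v * q"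
    using False assms by (intro Youngs_inequality_0) (auto simp: field_simps)
  then have "(p powr ?u * q powr ?v) ^ Suc t \<le> (?u * p + ?v * q) ^ Suc t"
    by (intro power_mono) auto
  also have "(p powr ?u * q powr ?v) ^ Suc t = p * q ^ t"
  proof -
    have "(q powr ?v) ^ Suc t = q powr (real (Suc t) * ?v)"
      using False by (intro powr_power) auto
    also have "real (Suc t) * ?v = real t"
      by simp
    also have "q powr real t = q ^ t"
      using False assms by (intro powr_realpow) auto
    finally show ?thesis
      using powr_inverse_power[of p "Suc t"] assms by (simp only: power_mult_distrib)
  qed
  also have "?u * p + ?v * q = (p + real t * q) / real (Suc t)"
    by (simp add: add_divide_distrib)
  finally show ?thesis .
qed (use assms in \<open>cases t; auto\<close>)

section \<open>Comparing products of model sets\<close>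

text \<open>Reshaping an interval of length \<open>l\<close> times a \<open>t\<close>-cube into a cube of the same volume
  does not increase the thickened volume.  Writing \<open>x\<close> and \<open>z\<close> for the sides of the two cubes, this is the
  superadditivity of the geometric mean of \<open>Suc t\<close> numbers, of which \<open>t\<close> coincide: divide both
  summands by the geometric mean \<open>G\<close> of the sums and bound each quotient by an arithmetic mean;
  the two arithmetic means add up to \<open>1\<close>.\<close>

lemma cube_growth_product:
  assumes "e > 0" "t \<ge> 1" "l \<ge> 0" "c \<ge> 0"
  shows "cube_growth e (Suc t) (l * c) \<le> (l + e) * cube_growth e t c"
proof -
  define x where "x = c powr (1 / real t)"
  define z where "z = (l * c) powr (1 / real (Suc t))"
  define G where "G = ((l + e) * (x + e) ^ t) powr (1 / real (Suc t))"
  have nonneg: "x \<ge> 0" "z \<ge> 0" "G \<ge> 0"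
    by (auto simp: x_def z_def G_def)
  have pos: "l + e > 0" "x + e > 0"
    using assms nonneg by auto
  have x: "x ^ t = c" and z: "z ^ Suc t = l * c"
    unfolding x_def z_def using assms by (intro powr_inverse_power; simp)+
  have G: "G ^ Suc t = (l + e) * (x + e) ^ t"
    unfolding G_def using assms pos by (intro powr_inverse_power) auto
  then have "G > 0"
    using nonneg(3) pos by (cases "G = 0") auto
  define m where "m a b = (a / (l + e) + real t * (b / (x + e))) / real (Suc t)" for a b
  have bound: "y \<le> m a b * G" if "y \<ge> 0" "a \<ge> 0" "b \<ge> 0" "y ^ Suc t = a * b ^ t" for y a b
  proof -
    have "(y / G) ^ Suc t = (a / (l + e)) * (b / (x + e)) ^ t"
      by (simp only: power_divide that(4) G) (simp add: power_divide)
    also have "\<dots> \<le> m a b ^ Suc t"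
      unfolding m_def using that pos by (intro weighted_mean_power_ge) auto
    finally have "y / G \<le> m a b"
      by (rule power_le_imp_le_base) (use that pos in \<open>auto simp: m_def\<close>)
    then show ?thesis
      using \<open>G > 0\<close> by (simp add: pos_divide_le_eq)
  qed
  have "m l x + m e e = ((l + e) / (l + e) + real t * ((x + e) / (x + e))) / real (Suc t)"
    unfolding m_def by (simp only: add_divide_distrib ring_distribs)
  also have "\<dots> = 1"
    using pos by simp
  finally have "z + e \<le> G"
    using bound[of z l x] bound[of e e e] nonneg assms x z
    by (smt (verit) distrib_right mult_cancel_right1 power_Suc)
  then have "(z + e) ^ Suc t \<le> G ^ Suc t"
    using nonneg assms by (intro power_mono) auto
  then show ?thesis
    by (simp only: G) (simp only: cube_growth_def z_def x_def)
qed

lemma cube_shrink_product: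
  assumes "e > 0" "t \<ge> 1" "b \<ge> 0" "e \<le> l"
  shows "(l - e) * cube_shrink e t b \<le> cube_shrink e (Suc t) (l * b)"
proof (cases "b powr (1 / real t) \<le> e")
  case True
  then have "cube_shrink e t b = 0"
    using assms by (simp add: cube_shrink_def)
  then show ?thesis
    by (simp add: cube_shrink_nonneg)
next
  case False
  then have "cube_growth e t (cube_shrink e t b) = b"
    using assms
    by (simp add: cube_growth_def cube_shrink_def power_powr_inverse powr_inverse_power)
  then have "cube_growth e (Suc t) ((l - e) * cube_shrink e t b) \<le> l * b"
    using cube_growth_product[of e t "l - e" "cube_shrink e t b"] assms cube_shrink_nonneg by simp
  then show ?thesis
    using assms cube_shrink_nonneg by (intro le_cube_shrink) auto
qed

text \<open>With \<open>u = 1 - v\<close> the difference \<open>r v\<close> between the two sides vanishes at \<open>0\<close> and at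
  \<open>1 / 2\<close> and is concave in between.  Since \<open>r\<close> need not be differentiable at \<open>0\<close>,
  concavity is applied through the mean value theorem on the two halves of the interval.\<close>

lemma powr_diff_le:
  fixes u v p :: real
  assumes p: "0 < p" "p \<le> 1" and "u + v = 1" "0 \<le> v" "v \<le> u"
  shows "u powr p - v powr p \<le> u - v"
proof (cases "v = 0 \<or> v = u")
  case False
  then have v: "0 < v" "v < 1 / 2"
    using assms by auto
  define r where "r x = x powr p - (1 - x) powr p + 1 - 2 * x" for x :: real
  define r' where "r' x = p * x powr (p - 1) + p * (1 - x) powr (p - 1) - 2" for x :: real
  have deriv: "(r has_real_derivative r' x) (at x)" if "0 < x" "x < 1" for x
    unfolding r_def r'_def using that by (auto intro!: derivative_eq_intros)
  have cont: "continuous_on {a..b} r" if "0 \<le> a" "b < 1" for a b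
    unfolding r_def using that p by (intro continuous_intros continuous_on_powr') auto
  have mvt: "\<exists>x>a. x < b \<and> r b - r a = (b - a) * r' x" if ab: "0 \<le> a" "a < b" "b < 1" for a b
  proof -
    have "r differentiable (at x)" if "a < x" "x < b" for x
      using deriv[of x] that ab by (auto simp: real_differentiable_def)
    then obtain d x where x: "a < x" "x < b" "(r has_real_derivative d) (at x)"
      "r b - r a = (b - a) * d"
      using MVT[OF ab(2) cont[OF ab(1,3)]] by blast
    moreover have "d = r' x"
      using DERIV_unique[OF x(3) deriv] x(1,2) ab by simp
    ultimately show ?thesis
      by blast
  qed
  have anti: "r' y \<le> r' x" if "0 < x" "x \<le> y" "y \<le> 1 / 2" for x y
  proof (rule DERIV_nonpos_imp_nonincreasing[OF that(2)])
    fix s assume "x \<le> s" "s \<le> y"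
    then have s: "0 < s" "s \<le> 1 - s"
      using that by auto
    have "(1 - s) powr (p - 2) \<le> s powr (p - 2)"
      using s p by (intro powr_mono2') auto
    then have "p * (p - 1) * (s powr (p - 2) - (1 - s) powr (p - 2)) \<le> 0"
      using p by (intro mult_nonpos_nonneg mult_nonneg_nonpos) auto
    moreover have "(r' has_real_derivative p * (p - 1) * (s powr (p - 2) - (1 - s) powr (p - 2))) (at s)"
      unfolding r'_def using s by (auto intro!: derivative_eq_intros simp: algebra_simps)
    ultimately show "\<exists>d. (r' has_real_derivative d) (at s) \<and> d \<le> 0"
      by blast
  qed
  have ends: "r 0 = 0" "r (1 / 2) = 0"
    by (auto simp: r_def)
  have "r v \<ge> 0"
  proof (rule ccontr)
    assume "\<not> r v \<ge> 0"
    obtain x where x: "0 < x" "x < v" "r v - r 0 = (v - 0) * r' x"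
      using mvt[of 0 v] v by auto
    obtain y where y: "v < y" "y < 1 / 2" "r (1 / 2) - r v = (1 / 2 - v) * r' y"
      using mvt[of v "1 / 2"] v by auto
    have "r' x < 0" "r' y > 0"
      using x y v ends \<open>\<not> r v \<ge> 0\<close> by (smt (verit) mult_nonneg_nonneg mult_nonneg_nonpos)+
    then show False
      using anti[of x y] x y by linarith
  qed
  moreover have "u = 1 - v"
    using assms by simp
  ultimately show ?thesis
    by (simp add: r_def)
qed (use assms in auto)

text \<open>The loss \<open>b - cube_shrink e t b\<close> is concave in \<open>b\<close>, so it is bounded below by its chords.
  The breakpoint \<open>((1 + e) / 2)\<^sup>2\<close> is the area of the square hole that loses exactly \<open>e\<close>, as
  much as a hole in the shape of an interval does; by \<open>powr_diff_le\<close> a hole of the same volume in more dimensions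
  loses at least as much.\<close>

lemma cube_shrink_le_linear:
  assumes e: "0 < e" "e < 1" and t: "t \<ge> 2" and b: "0 \<le> b" "b \<le> 1"
  shows "cube_shrink e t b \<le> b - e * min 1 (b / ((1 + e) / 2)\<^sup>2)"
proof -
  define u v where "u = (1 + e) / 2" and "v = (1 - e) / 2"
  define \<beta> where "\<beta> = u\<^sup>2"
  have uv: "u + v = 1" "u - v = e" "0 < v" "v < u" "u < 1"
    using e by (auto simp: u_def v_def field_simps)
  have \<beta>: "0 < \<beta>" "\<beta> < 1" "\<beta> - e = v\<^sup>2"
  proof -
    show "0 < \<beta>" "\<beta> < 1"
      using uv power_strict_mono[of u 1 2] by (auto simp: \<beta>_def)
    show "\<beta> - e = v\<^sup>2"
      by (simp add: \<beta>_def u_def v_def power2_eq_square field_simps)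
  qed
  have cvx: "convex_on {x..y} (cube_shrink e t)" if "0 \<le> x" for x y
    using convex_on_cube_shrink[of e t] e t that by (auto intro: convex_on_subset)
  have at_\<beta>: "cube_shrink e t \<beta> \<le> \<beta> - e"
  proof -
    have "u powr (2 / real t) - v powr (2 / real t) \<le> e"
      using powr_diff_le[of "2 / real t" u v] uv t by simp
    moreover have "(u\<^sup>2) powr (1 / real t) = u powr (2 / real t)" "(v\<^sup>2) powr (1 / real t) = v powr (2 / real t)"
      using uv by (auto simp: powr_powr simp flip: powr_numeral)
    ultimately have "\<beta> powr (1 / real t) \<le> (\<beta> - e) powr (1 / real t) + e"
      unfolding \<beta> by (simp add: \<beta>_def)
    then have "(\<beta> powr (1 / real t)) ^ t \<le> cube_growth e t (\<beta> - e)"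
      unfolding cube_growth_def by (intro power_mono) auto
    then show ?thesis
      using e t \<beta> by (subst cube_shrink_le_iff) (auto simp: powr_inverse_power)
  qed
  have at_1: "cube_shrink e t 1 \<le> 1 - e"
    using e t power_decreasing[of 1 t "1 - e"] by (simp add: cube_shrink_def)
  have at_0: "cube_shrink e t 0 = 0"
    using e t by (simp add: cube_shrink_def)
  show ?thesis
  proof (cases "b \<le> \<beta>")
    case True
    have "cube_shrink e t b \<le> cube_shrink e t \<beta> / \<beta> * b"
      using convex_onD_Icc'[OF cvx[of 0 \<beta>], of b] True b at_0 by simp
    also have "\<dots> \<le> (\<beta> - e) / \<beta> * b"
      using at_\<beta> \<beta> b by (intro mult_right_mono divide_right_mono) auto
    also have "\<dots> = b - e * (b / \<beta>)"
      using \<beta> by (simp add: field_simps)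
    finally show ?thesis
      using True \<beta> by (simp add: \<beta>_def u_def)
  next
    case False
    define s where "s = (b - \<beta>) / (1 - \<beta>)"
    have s: "0 \<le> s" "s \<le> 1"
      using False \<beta> b by (auto simp: s_def field_simps)
    have b_eq: "b = (1 - s) * \<beta> + s * 1"
    proof -
      have "s * (1 - \<beta>) = b - \<beta>"
        using \<beta>(2) by (simp add: s_def)
      then show ?thesis
        by (simp add: algebra_simps)
    qed
    have "cube_shrink e t b \<le> (1 - s) * cube_shrink e t \<beta> + s * cube_shrink e t 1"
      using convex_onD[OF cvx[of 0 1], of s \<beta> 1] s \<beta> b_eq by simp
    also have "\<dots> \<le> (1 - s) * (\<beta> - e) + s * (1 - e)"
      using s at_\<beta> at_1 by (intro add_mono mult_left_mono) auto
    also have "\<dots> = b - e"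
      using b_eq by (simp add: algebra_simps)
    finally show ?thesis
      using False \<beta> e by (auto simp: \<beta>_def[symmetric] u_def[symmetric] min_def field_simps)
  qed
qed

text \<open>This is \<open>mixed_product\<close> after the losses have been replaced by their piecewise linear bounds.
  Beyond the breakpoint it is the arithmetic-geometric mean inequality for \<open>l\<close> and \<open>c\<close>, and for \<open>l + e \<ge> \<beta>\<close>
  the right-hand side is at least \<open>1\<close>.  What remains is a quadratic inequality in \<open>sqrt c\<close>: either its
  discriminant is nonpositive, or its vertex lies at \<open>1\<close> or to the right of it, so that the worst case is \<open>c = 1\<close>.\<close>

lemma quadratic_estimate:
  fixes e l c :: real
  defines "\<beta> \<equiv> ((1 + e) / 2)\<^sup>2"
  assumes e: "0 < e" "e < 1" and l: "0 \<le> l" and c: "0 \<le> c" "c \<le> 1"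
  shows "min 1 (2 * sqrt (l * c) + e) \<le> (l + e) * min 1 ((1 - c) / \<beta>) + c"
proof -
  define y w where "y = sqrt c" and "w = sqrt l"
  have y: "0 \<le> y" "y \<le> 1" "c = y\<^sup>2" and w: "0 \<le> w" "l = w\<^sup>2"
    using c l by (auto simp: y_def w_def)
  have yw: "sqrt (l * c) = w * y"
    by (simp add: y_def w_def real_sqrt_mult)
  have \<beta>: "0 < \<beta>" "2 * \<beta> \<le> 1 + e" "e \<le> \<beta>" "\<beta> < 1"
  proof -
    have "\<beta> \<le> (1 + e) / 2 * 1"
      unfolding \<beta>_def power2_eq_square using e by (intro mult_left_mono) auto
    then show "2 * \<beta> \<le> 1 + e" "\<beta> < 1"
      using e by auto
    have "(1 - e)\<^sup>2 \<ge> 0"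
      by simp
    then show "e \<le> \<beta>"
      by (simp add: \<beta>_def power_divide power2_eq_square algebra_simps)
    show "0 < \<beta>"
      using e by (simp add: \<beta>_def)
  qed
  consider "1 - c \<ge> \<beta>" | "1 - c < \<beta>" "l + e \<ge> \<beta>" | "1 - c < \<beta>" "l + e < \<beta>"
    by linarith
  then show ?thesis
  proof cases
    case 1
    have "(w - y)\<^sup>2 \<ge> 0"
      by simp
    then have "2 * (w * y) + e \<le> l + e + c"
      by (simp add: y w power2_eq_square algebra_simps)
    then show ?thesis
      using 1 \<beta> by (simp add: yw min_def)
  next
    case 2
    have "(1 - c) * \<beta> \<le> (1 - c) * (l + e)"
      using 2 c by (intro mult_left_mono) auto
    then have "1 - c \<le> (l + e) * ((1 - c) / \<beta>)"
      using \<beta> by (simp add: field_simps)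
    then show ?thesis
      using 2 \<beta> by (simp add: min_def)
  next
    case 3
    define q where "q = (l + e) / \<beta>"
    have q: "0 < q" "q < 1" "l = q * \<beta> - e"
      using 3 \<beta> e l by (auto simp: q_def)
    have "2 * w * y \<le> (1 - q) * y\<^sup>2 + (q - e)"
    proof (cases "q \<le> 1 + e - \<beta>")
      case True
      \<comment> \<open>The discriminant of the quadratic polynomial in \<open>y\<close> is nonpositive.\<close>
      have "(1 - q) * (q - e) - l = q * (1 + e - \<beta> - q)"
        by (simp add: q(3) algebra_simps)
      then have "(1 - q) * (q - e) - w\<^sup>2 \<ge> 0"
        using True q by (simp add: w(2))
      then have "((1 - q) * y - w)\<^sup>2 + ((1 - q) * (q - e) - w\<^sup>2) \<ge> 0"
        by simp
      also have "((1 - q) * y - w)\<^sup>2 + ((1 - q) * (q - e) - w\<^sup>2)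
          = (1 - q) * ((1 - q) * y\<^sup>2 + (q - e) - 2 * w * y)"
        by (simp add: power2_eq_square algebra_simps)
      finally show ?thesis
        using q by (simp add: zero_le_mult_iff)
    next
      case False
      \<comment> \<open>The vertex \<open>w / (1 - q)\<close> is at least \<open>1\<close>, so the polynomial decreases up to \<open>y = 1\<close>.\<close>
      have "(1 - q)\<^sup>2 \<le> (\<beta> - e)\<^sup>2"
        using False q by (intro power_mono) auto
      also have "\<dots> \<le> (\<beta> - e) * (1 - \<beta>)"
        using \<beta> unfolding power2_eq_square by (intro mult_left_mono) auto
      also have "\<dots> = (1 + e - \<beta>) * \<beta> - e"
        by (simp add: algebra_simps)
      also have "\<dots> \<le> w\<^sup>2"
        using False \<beta> unfolding w(2)[symmetric] q(3) by simp
      finally have qw: "1 - q \<le> w"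
        using w(1) by (rule power2_le_imp_le)
      have "l \<le> ((1 - e) / 2)\<^sup>2"
        using 3 by (simp add: \<beta>_def power2_eq_square field_simps)
      then have w_le: "w \<le> (1 - e) / 2"
        unfolding w(2) using e by (intro power2_le_imp_le[of w]) auto
      have "(1 - y) * ((1 - q) * (1 + y)) \<le> (1 - y) * (2 * w)"
        using qw y q mult_mono[of "1 - q" w "1 + y" 2] w by (intro mult_left_mono) (auto simp: mult.commute)
      then have "2 * w * y - (1 - q) * y\<^sup>2 \<le> 2 * w - (1 - q)"
        by (simp add: power2_eq_square algebra_simps)
      then show ?thesis
        using w_le by argo
    qed
    also have "\<dots> = q * (1 - c) + c - e"
      by (simp add: y algebra_simps)
    finally show ?thesis
      using 3 \<beta> by (simp add: yw q_def)
  qed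
qed

lemma cube_growth_1: "y \<ge> 0 \<Longrightarrow> cube_growth e 1 y = y + e"
  by (simp add: cube_growth_def)

lemma cube_growth_2: "y \<ge> 0 \<Longrightarrow> cube_growth e 2 y = (sqrt y + e)\<^sup>2"
  by (simp add: cube_growth_def powr_half_sqrt)

text \<open>An interval of length \<open>l\<close> times the complement of a \<open>t\<close>-cube, of volume \<open>c\<close>, is
  compared with an interval and a square of volume \<open>l * c\<close>.  The complement is
  credited with at most the growth of an interval, which is all that the profile can claim.  If the
  hole is large, the bounds below let both factors grow like intervals, and the square does no worse by the
  arithmetic-geometric mean inequality.  If the hole is small, the linear bound of
  \<open>cube_shrink_le_linear\<close> remains.  As that bound is the same for every \<open>t\<close>, models of dimension
  one and two suffice.\<close>

lemma mixed_product:
  assumes e: "0 < e" "e < 1" and t: "t \<ge> 2" and l: "0 \<le> l" and c: "0 \<le> c" "c \<le> 1"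
  shows "min (cube_growth e 1 (l * c)) (cube_growth e 2 (l * c))
    \<le> (l + e) * min (cube_growth e 1 c) (1 - cube_shrink e t (1 - c))"
proof -
  define d where "d = min 1 ((1 - c) / ((1 + e) / 2)\<^sup>2)"
  have "e * min 1 (2 * sqrt (l * c) + e) \<le> e * ((l + e) * d + c)"
    using quadratic_estimate[OF e l c] e by (intro mult_left_mono) (auto simp: d_def)
  moreover have "min (cube_growth e 1 (l * c)) (cube_growth e 2 (l * c))
      = l * c + e * min 1 (2 * sqrt (l * c) + e)"
  proof -
    have "cube_growth e 1 (l * c) = l * c + e * 1"
      using c l by (simp add: cube_growth_1 del: One_nat_def)
    moreover have "cube_growth e 2 (l * c) = l * c + e * (2 * sqrt (l * c) + e)"
      using c l by (simp add: cube_growth_2 power2_sum) (simp add: power2_eq_square algebra_simps)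
    moreover have "min (l * c + e * x) (l * c + e * y) = l * c + e * min x y" for x y
      using e by (auto simp: min_def)
    ultimately show ?thesis
      by (simp only:)
  qed
  ultimately have "min (cube_growth e 1 (l * c)) (cube_growth e 2 (l * c)) \<le> (l + e) * (c + e * d)"
    by (simp add: algebra_simps)
  also have "\<dots> \<le> (l + e) * min (cube_growth e 1 c) (1 - cube_shrink e t (1 - c))"
    using cube_shrink_le_linear[OF e t, of "1 - c"] c l e
    by (intro mult_left_mono) (auto simp: cube_growth_1 d_def mult_left_le simp del: One_nat_def)
  finally show ?thesis .
qed

section \<open>The isoperimetric profile\<close>

text \<open>The value at \<open>0\<close> is the volume of the neighbourhood of the empty set, which lies below the limit of the
  minimum.  This downward jump at the endpoint preserves concavity.  In dimension \<open>0\<close> the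
  profile is \<open>1\<close> off the origin, so the induction can start with a single point.\<close>

definition profile :: "real \<Rightarrow> nat \<Rightarrow> real \<Rightarrow> real" where
  "profile e n a = (if a = 0 then 0 else
     Min (insert 1 (\<Union>t\<in>{1..n}. {cube_growth e t a, 1 - cube_shrink e t (1 - a)})))"

lemma profile_0 [simp]: "profile e n 0 = 0"
  by (simp add: profile_def)

lemma profile_le_1: "profile e n a \<le> 1"
  by (auto simp: profile_def)

lemma profile_le_growth:
  assumes "e \<ge> 0" "t \<in> {1..n}"
  shows "profile e n a \<le> cube_growth e t a"
  using assms by (auto simp: profile_def cube_growth_nonneg intro!: Min_le)

lemma cube_shrink_le_1:
  assumes "e \<ge> 0" "0 \<le> b" "b \<le> 1"
  shows "cube_shrink e t b \<le> 1"
proof -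
  have "b powr (1 / real t) \<le> 1"
    using assms by (intro powr_le1) auto
  then show ?thesis
    unfolding cube_shrink_def using assms by (intro power_le_one) auto
qed

lemma profile_le_shrink:
  assumes "e \<ge> 0" "t \<in> {1..n}"
  shows "profile e n a \<le> 1 - cube_shrink e t (1 - a)"
  using assms cube_shrink_le_1[of e 1 t] by (auto simp: profile_def intro!: Min_le)

lemma profile_cases:
  assumes "a \<noteq> 0"
  obtains "profile e n a = 1"
  | t where "t \<in> {1..n}" "profile e n a = cube_growth e t a"
  | t where "t \<in> {1..n}" "profile e n a = 1 - cube_shrink e t (1 - a)"
proof -
  let ?S = "insert 1 (\<Union>t\<in>{1..n}. {cube_growth e t a, 1 - cube_shrink e t (1 - a)})"
  have "Min ?S \<in> ?S"
    by (intro Min_in) auto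
  then show ?thesis
    using that assms by (auto simp: profile_def)
qed

lemma profile_1:
  assumes "e > 0"
  shows "profile e n 1 = 1"
proof (rule antisym)
  show "1 \<le> profile e n 1"
    by (cases rule: profile_cases[of 1 e n])
       (use assms in \<open>auto simp: cube_growth_def cube_shrink_def power_0_left intro!: one_le_power\<close>)
qed (rule profile_le_1)

lemma profile_mono:
  assumes "e \<ge> 0" "0 \<le> x" "x \<le> y" "y \<le> 1"
  shows "profile e n x \<le> profile e n y"
proof (cases "y = 0")
  case False
  then show ?thesis
  proof (cases rule: profile_cases[of y e n])
    case 1
    then show ?thesis
      by (simp add: profile_le_1)
  next
    case (2 t)
    then show ?thesis
      using profile_le_growth[of e t n x] cube_growth_mono[of e x y t] assms by simp
  next
    case (3 t)
    then show ?thesis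
      using profile_le_shrink[of e t n x] cube_shrink_mono[of "1 - y" "1 - x" e t] assms by simp
  qed
qed (use assms in auto)

lemma profile_Suc_le:
  assumes "e \<ge> 0"
  shows "profile e (Suc n) a \<le> profile e n a"
proof (cases "a = 0")
  case False
  then show ?thesis
  proof (cases rule: profile_cases[of a e n])
    case 1
    then show ?thesis
      by (simp add: profile_le_1)
  next
    case (2 t)
    then show ?thesis
      using profile_le_growth[of e t "Suc n" a] assms by simp
  next
    case (3 t)
    then show ?thesis
      using profile_le_shrink[of e t "Suc n" a] assms by simp
  qed
qed simp

lemma concave_on_profile:
  assumes e: "e \<ge> 0"
  shows "concave_on {0..1} (profile e n)"
  unfolding concave_on_iff
proof (intro conjI ballI allI impI)
  fix x y u v :: real
  assume "x \<in> {0..1}" "y \<in> {0..1}" and uv: "0 \<le> u" "0 \<le> v" "u + v = 1"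
  then have xy: "0 \<le> x" "x \<le> 1" "0 \<le> y" "y \<le> 1"
    by auto
  define z where "z = u * x + v * y"
  have bound: "u * profile e n x + v * profile e n y \<le> f z"
    if "u * f x + v * f y \<le> f z" "profile e n x \<le> f x" "profile e n y \<le> f y" for f
    using that uv by (smt (verit) mult_left_mono)
  have "u * profile e n x + v * profile e n y \<le> profile e n z"
  proof (cases "z = 0")
    case True
    then have "u * x = 0" "v * y = 0"
      using xy uv by (auto simp: z_def add_nonneg_eq_0_iff)
    then show ?thesis
      using True by auto
  next
    case False
    then show ?thesis
    proof (cases rule: profile_cases[of z e n])
      case 1
      then show ?thesis
        using bound[of "\<lambda>_. 1"] uv by (simp add: profile_le_1)
    next
      case (2 t)
      have "u * cube_growth e t x + v * cube_growth e t y \<le> cube_growth e t z"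
        using concave_on_cube_growth[of e t] 2 e xy uv by (auto simp: concave_on_iff z_def)
      then show ?thesis
        unfolding 2(2) using 2(1) e by (intro bound profile_le_growth) auto
    next
      case (3 t)
      have "1 - z = u * (1 - x) + v * (1 - y)"
        using uv by (simp add: z_def algebra_simps)
      then have "cube_shrink e t (1 - z) \<le> u * cube_shrink e t (1 - x) + v * cube_shrink e t (1 - y)"
        using convex_on_cube_shrink[of e t] 3 e xy uv by (auto simp: convex_on_def)
      then have "u * (1 - cube_shrink e t (1 - x)) + v * (1 - cube_shrink e t (1 - y))
          \<le> 1 - cube_shrink e t (1 - z)"
        using uv by (simp add: algebra_simps)
      then show ?thesis
        unfolding 3(2) using 3(1) e
        by (intro bound[of "\<lambda>a. 1 - cube_shrink e t (1 - a)"] profile_le_shrink) auto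
    qed
  qed
  then show "u * profile e n x + v * profile e n y \<le> profile e n (u *\<^sub>R x + v *\<^sub>R y)"
    by (simp add: z_def)
qed auto

lemma cube_shrink_1: "b \<ge> 0 \<Longrightarrow> cube_shrink e 1 b = max 0 (b - e)"
  by (simp add: cube_shrink_def)

text \<open>Lower level \<open>0\<close>: an interval of length \<open>l\<close> times an optimal set of volume \<open>c\<close>.\<close>

lemma profile_product_empty:
  assumes e: "0 < e" "e < 1" and l: "0 \<le> l" and c: "0 \<le> c" "c \<le> 1"
  shows "profile e (Suc n) (l * c) \<le> (l + e) * profile e n c"
proof (cases "c = 0")
  case False
  have growth: "profile e (Suc n) (l * c) \<le> cube_growth e t (l * c)" if "t \<in> {1..Suc n}" for t
    using that e by (intro profile_le_growth) auto
  from False show ?thesis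
  proof (cases rule: profile_cases[of c e n])
    case 1
    have "profile e (Suc n) (l * c) \<le> l * c + e"
      using growth[of 1] cube_growth_1[of "l * c" e] l c by simp
    also have "\<dots> \<le> l + e"
      using l c by (simp add: mult_left_le)
    finally show ?thesis
      using 1 by simp
  next
    case (2 t)
    have "profile e (Suc n) (l * c) \<le> cube_growth e (Suc t) (l * c)"
      using 2 by (intro growth) auto
    also have "\<dots> \<le> (l + e) * cube_growth e t c"
      using 2 e l c by (intro cube_growth_product) auto
    finally show ?thesis
      using 2 by simp
  next
    case (3 t)
    have le_1: "profile e n c \<le> cube_growth e 1 c"
      using 3 e by (intro profile_le_growth) auto
    have "n \<ge> 1"
      using 3 by auto
    show ?thesis
    proof (cases "t = 1")
      case True
      have "profile e n c = 1 \<or> profile e n c = cube_growth e 1 c"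
        using 3(2) True c by (auto simp: cube_shrink_1 cube_growth_1 max_def simp del: One_nat_def)
      then show ?thesis
      proof
        assume *: "profile e n c = 1"
        have "profile e (Suc n) (l * c) \<le> l * c + e"
          using growth[of 1] cube_growth_1[of "l * c" e] l c by simp
        also have "\<dots> \<le> l + e"
          using l c by (simp add: mult_left_le)
        finally show ?thesis
          using * by simp
      next
        assume *: "profile e n c = cube_growth e 1 c"
        have "profile e (Suc n) (l * c) \<le> cube_growth e (Suc 1) (l * c)"
          using \<open>n \<ge> 1\<close> by (intro growth) auto
        also have "\<dots> \<le> (l + e) * cube_growth e 1 c"
          using e l c by (intro cube_growth_product) auto
        finally show ?thesis
          using * by simp
      qed
    next
      case False
      have "profile e (Suc n) (l * c) \<le> min (cube_growth e 1 (l * c)) (cube_growth e 2 (l * c))"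
        using growth[of 1] growth[of 2] \<open>n \<ge> 1\<close> by auto
      also have "\<dots> \<le> (l + e) * min (cube_growth e 1 c) (1 - cube_shrink e t (1 - c))"
        using False 3(1) e l c by (intro mixed_product) auto
      also have "min (cube_growth e 1 c) (1 - cube_shrink e t (1 - c)) = profile e n c"
        using le_1 3(2) by simp
      finally show ?thesis .
    qed
  qed
qed simp

text \<open>Upper level \<open>1\<close>: the part left out is an interval of length \<open>1 - l\<close> times the complement of an
  optimal set of volume \<open>c\<close>.  For cubes of dimension at least two this is \<open>mixed_product\<close>, applied to the complement of the thickened set.\<close>

lemma profile_product_full:
  assumes e: "0 < e" "e < 1" and l: "0 \<le> l" "l + e \<le> 1" and c: "0 \<le> c" "c \<le> 1"
  shows "profile e (Suc n) (l + (1 - l) * c) \<le> (l + e) + (1 - l - e) * profile e n c"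
proof (cases "c = 0")
  case True
  have "profile e (Suc n) l \<le> l + e"
    using profile_le_growth[of e 1 "Suc n" l] cube_growth_1[of l e] e l by simp
  then show ?thesis
    using True by simp
next
  case False
  define a where "a = l + (1 - l) * c"
  have compl: "1 - a = (1 - l) * (1 - c)"
    by (simp add: a_def algebra_simps)
  have compl_nonneg: "1 - a \<ge> 0"
    unfolding compl using l c e by simp
  have shrink: "profile e (Suc n) a \<le> 1 - cube_shrink e t (1 - a)" if "t \<in> {1..Suc n}" for t
    using that e by (intro profile_le_shrink) auto
  have step: "profile e (Suc n) a \<le> (l + e) + (1 - l - e) * (1 - cube_shrink e t (1 - c))"
    if "t \<in> {1..n}" for t
  proof -
    have "(1 - l - e) * cube_shrink e t (1 - c) \<le> cube_shrink e (Suc t) (1 - a)"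
      unfolding compl using that e l c cube_shrink_product[of e t "1 - c" "1 - l"] by simp
    then show ?thesis
      using shrink[of "Suc t"] that by (simp add: algebra_simps)
  qed
  from False have "profile e (Suc n) a \<le> (l + e) + (1 - l - e) * profile e n c"
  proof (cases rule: profile_cases[of c e n])
    case 1
    then show ?thesis
      using profile_le_1[of e "Suc n" a] by simp
  next
    case (3 t)
    then show ?thesis
      using step[of t] by simp
  next
    case (2 t)
    have "n \<ge> 1"
      using 2 by auto
    have growth_le: "cube_growth e t c \<le> 1" "cube_growth e t c \<le> cube_growth e 1 c"
      using profile_le_1[of e n c] profile_le_growth[of e 1 n c] 2 \<open>n \<ge> 1\<close> e by auto
    show ?thesis
    proof (cases "t = 1")
      case True
      have "1 - cube_shrink e 1 (1 - c) = profile e n c"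
        using growth_le 2(2) True c
        by (simp add: cube_shrink_1 cube_growth_1 max_def del: One_nat_def)
      then show ?thesis
        using step[of 1] \<open>n \<ge> 1\<close> by simp
    next
      case False
      \<comment> \<open>The complement of the thickened cube, of volume \<open>d\<close>, thickens to the complement of the
        cube, of volume \<open>1 - c\<close>; likewise the interval of length \<open>1 - l - e\<close> to \<open>1 - l\<close>.\<close>
      define d where "d = 1 - cube_growth e t c"
      have d: "0 \<le> d" "d \<le> 1"
        using growth_le cube_growth_nonneg[of e t c] e by (auto simp: d_def)
      have "cube_shrink e t (1 - d) = c"
        using 2 e c by (simp add: d_def cube_shrink_cube_growth)
      then have "min (cube_growth e 1 ((1 - l - e) * d)) (cube_growth e 2 ((1 - l - e) * d))
          \<le> (1 - l - e + e) * min (cube_growth e 1 d) (1 - c)"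
        using mixed_product[of e t "1 - l - e" d] False 2(1) e l d by simp
      also have "min (cube_growth e 1 d) (1 - c) = 1 - c"
        using growth_le c d by (simp add: cube_growth_1 d_def del: One_nat_def)
      also have "(1 - l - e + e) * (1 - c) = 1 - a"
        by (simp add: compl)
      finally obtain s where s: "s \<in> {1, 2}" "cube_growth e s ((1 - l - e) * d) \<le> 1 - a"
        by (auto simp: min_le_iff_disj)
      then have "(1 - l - e) * d \<le> cube_shrink e s (1 - a)"
        using e l d by (intro le_cube_shrink) auto
      moreover have "profile e (Suc n) a \<le> 1 - cube_shrink e s (1 - a)"
        using s \<open>n \<ge> 1\<close> by (intro shrink) auto
      ultimately show ?thesis
        using 2(2) by (simp add: d_def algebra_simps)
    qed
  qed
  then show ?thesis
    by (simp add: a_def)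
qed

text \<open>Let the levels \<open>M\<close> and \<open>m\<close> move apart from their mean \<open>a\<close> along the line on which the mean is constant, until
  one of them reaches the boundary of the unit interval.  Along this segment the right-hand side is concave,
  so it suffices to check the two ends: equal levels, and \<open>m = 0\<close> or \<open>M = 1\<close>,
  whichever happens first.\<close>

lemma profile_two_level:
  assumes e: "0 < e" "e < 1" and l: "0 < l" "l + e \<le> 1" and mM: "0 \<le> m" "m \<le> M" "M \<le> 1"
  shows "profile e (Suc n) (l * M + (1 - l) * m)
    \<le> (l + e) * profile e n M + (1 - l - e) * profile e n m"
proof -
  define a where "a = l * M + (1 - l) * m"
  have l1: "l < 1"
    using e l by simp
  have a: "m \<le> a" "a \<le> M"
  proof -
    have "l * (M - m) \<ge> 0" "(1 - l) * (M - m) \<ge> 0"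
      using l l1 mM by auto
    then show "m \<le> a" "a \<le> M"
      by (auto simp: a_def algebra_simps)
  qed
  have interp: "profile e n ((1 - s) * x + s * y) \<ge> (1 - s) * profile e n x + s * profile e n y"
    if "0 \<le> s" "s \<le> 1" "0 \<le> x" "x \<le> 1" "0 \<le> y" "y \<le> 1" for s x y
    using concave_onD[OF concave_on_profile[of e n], of s x y] that e by simp
  have diag: "profile e (Suc n) a \<le> (l + e) * profile e n a + (1 - l - e) * profile e n a"
    using profile_Suc_le[of e n a] e by (simp add: algebra_simps)
  have extremal: ?thesis
    if xy: "0 \<le> y" "y \<le> 1" "0 \<le> x" "x \<le> 1"
      and bound: "profile e (Suc n) a \<le> (l + e) * profile e n x + (1 - l - e) * profile e n y"
      and s: "0 \<le> s" "s \<le> 1" "M = (1 - s) * a + s * x" "m = (1 - s) * a + s * y" for x y s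
  proof -
    have "profile e (Suc n) a = (1 - s) * profile e (Suc n) a + s * profile e (Suc n) a"
      by (simp add: algebra_simps)
    also have "\<dots> \<le> (1 - s) * ((l + e) * profile e n a + (1 - l - e) * profile e n a)
        + s * ((l + e) * profile e n x + (1 - l - e) * profile e n y)"
      using diag bound s by (intro add_mono mult_left_mono) auto
    also have "\<dots> = (l + e) * ((1 - s) * profile e n a + s * profile e n x)
        + (1 - l - e) * ((1 - s) * profile e n a + s * profile e n y)"
      by (simp add: algebra_simps)
    also have "\<dots> \<le> (l + e) * profile e n M + (1 - l - e) * profile e n m"
      unfolding s(3,4) using e l s xy a mM by (intro add_mono mult_left_mono interp) auto
    finally show ?thesis
      by (simp add: a_def)
  qed
  show ?thesis
  proof (cases "m = M")
    case True
    then show ?thesis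
      using diag by (simp add: a_def algebra_simps)
  next
    case False
    then have "l * (M - m) > 0" "(1 - l) * (M - m) > 0"
      using l l1 mM by auto
    then have a_less: "m < a" "a < M"
      by (auto simp: a_def algebra_simps)
    have lever: "l * (M - a) = (1 - l) * (a - m)"
      by (simp add: a_def algebra_simps)
    show ?thesis
    proof (cases "a \<le> l")
      case True
      \<comment> \<open>The lower level reaches \<open>0\<close> first, when the upper level is \<open>a / l\<close>.\<close>
      define s where "s = (a - m) / a"
      have s: "0 \<le> s" "s \<le> 1" "s * a = a - m"
        using a_less mM by (auto simp: s_def)
      have "M = (1 - s) * a + s * (a / l)"
      proof -
        have "l * ((1 - s) * a + s * (a / l)) = l * a + (1 - l) * (s * a)"
          using l by (simp add: algebra_simps)
        also have "\<dots> = l * M"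
          unfolding s(3) lever[symmetric] by (simp add: algebra_simps)
        finally show ?thesis
          using l by simp
      qed
      moreover have "m = (1 - s) * a + s * 0"
        using s(3) by (simp add: algebra_simps)
      moreover have "profile e (Suc n) a \<le> (l + e) * profile e n (a / l)"
        using profile_product_empty[of e l "a / l" n] e l True a_less mM by simp
      ultimately show ?thesis
        using s l True a_less mM by (intro extremal[of 0 "a / l" s]) auto
    next
      case False
      \<comment> \<open>The upper level reaches \<open>1\<close> first, when the lower level is \<open>y\<close>.\<close>
      define y where "y = (a - l) / (1 - l)"
      have y: "0 \<le> y" "y \<le> 1" "l + (1 - l) * y = a"
        using False l1 a mM by (auto simp: y_def)
      define s where "s = (M - a) / (1 - a)"
      have s: "0 \<le> s" "s \<le> 1" "s * (1 - a) = M - a"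
        using a_less mM by (auto simp: s_def)
      have "m = (1 - s) * a + s * y"
      proof -
        have "(1 - l) * ((1 - s) * a + s * y) = (1 - l) * (1 - s) * a + s * ((1 - l) * y)"
          by (simp add: algebra_simps)
        also have "(1 - l) * y = a - l"
          using y(3) by simp
        also have "(1 - l) * (1 - s) * a + s * (a - l) = (1 - l) * a - l * (s * (1 - a))"
          by (simp add: algebra_simps)
        also have "\<dots> = (1 - l) * m"
          unfolding s(3) lever by (simp add: algebra_simps)
        finally show ?thesis
          using l1 by simp
      qed
      moreover have "M = (1 - s) * a + s * 1"
        using s(3) by (simp add: algebra_simps)
      moreover have "profile e n 1 = 1"
        using e by (intro profile_1) auto
      moreover have "profile e (Suc n) a \<le> (l + e) * 1 + (1 - l - e) * profile e n y"
        using profile_product_full[of e l y n] e l y by simp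
      ultimately show ?thesis
        using s y by (intro extremal[of y 1 s]) auto
    qed
  qed
qed

section \<open>Densities on a cycle\<close>

text \<open>Bound \<open>h j\<close> from below by \<open>g 0\<close> at the start, then by the left neighbour up to \<open>r\<close>, by \<open>g j\<close>
  itself between \<open>r\<close> and \<open>p\<close>, and by the right neighbour from \<open>p\<close> on.  Only \<open>g r\<close> and
  \<open>g p\<close> are missed, while the two ends of the path are gained.\<close>

lemma path_sum_ge:
  fixes g h :: "nat \<Rightarrow> real"
  assumes "\<And>j. g j \<le> h j" "\<And>j. g j \<le> h (Suc j)" "\<And>j. g (Suc j) \<le> h j"
    and "0 < r" "r < p" "p < k"
  shows "g 0 + (\<Sum>j<k. g j) + g k - g r - g p \<le> (\<Sum>j<k. h j)"
proof -
  have right: "g 0 + (\<Sum>j<m. g j) \<le> (\<Sum>j<Suc m. h j)" for m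
  proof (induction m)
    case (Suc m)
    then show ?case
      using assms(2)[of m] by simp
  qed (use assms(1)[of 0] in simp)
  have still: "g 0 + (\<Sum>j<m. g j) - g r \<le> (\<Sum>j<m. h j)" if "Suc r \<le> m" for m
    using that
  proof (induction m rule: dec_induct)
    case base
    then show ?case
      using right[of r] by simp
  next
    case (step m)
    then show ?case
      using assms(1)[of m] by simp
  qed
  have "g 0 + (\<Sum>j<Suc m. g j) - g r - g p \<le> (\<Sum>j<m. h j)" if "p \<le> m" for m
    using that
  proof (induction m rule: dec_induct)
    case base
    then show ?case
      using still[of p] assms by simp
  next
    case (step m)
    then show ?case
      using assms(3)[of m] by simp
  qed
  from this[of k] show ?thesis
    using assms by simp
qed

definition cycle_near :: "nat \<Rightarrow> int \<Rightarrow> int \<Rightarrow> bool" where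
  "cycle_near k u v \<longleftrightarrow> u = v \<or> [u - v = 1] (mod int k) \<or> [u - v = -1] (mod int k)"

text \<open>Cut the cycle open at \<open>x\<close>, so that both ends of the path are \<open>x\<close>.\<close>

lemma cycle_sum_ge:
  fixes g h :: "int \<Rightarrow> real"
  assumes gh: "\<And>x y. x \<in> {0..<int k} \<Longrightarrow> y \<in> {0..<int k} \<Longrightarrow> cycle_near k x y \<Longrightarrow> g x \<le> h y"
    and C: "x \<in> {0..<int k}" "r \<in> {0..<int k}" "p \<in> {0..<int k}"
    and distinct: "r \<noteq> x" "p \<noteq> x" "r \<noteq> p"
  shows "2 * g x + (\<Sum>y\<in>{0..<int k}. g y) - g r - g p \<le> (\<Sum>y\<in>{0..<int k}. h y)"
proof -
  define b where "b j = (x + int j) mod int k" for j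
  have k: "k > 0"
    using C by auto
  have b_mem: "b j \<in> {0..<int k}" for j
    using k by (simp add: b_def)
  have inv: "b (nat ((y - x) mod int k)) = y" "nat ((y - x) mod int k) < k" if "y \<in> {0..<int k}" for y
    using that k by (auto simp: b_def mod_simps nat_less_iff)
  have "inj_on b {..<k}"
  proof (rule inj_onI)
    fix i j assume ij: "i \<in> {..<k}" "j \<in> {..<k}" "b i = b j"
    then have "[int i = int j] (mod int k)"
      using cong_add_lcancel[of x "int i" "int j" "int k"] by (simp add: b_def cong_def)
    then show "i = j"
      using ij by (simp add: cong_def)
  qed
  moreover have "b ` {..<k} = {0..<int k}"
  proof
    show "{0..<int k} \<subseteq> b ` {..<k}"
      using inv by (metis image_eqI lessThan_iff subsetI)
  qed (use b_mem in auto)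
  ultimately have bij: "bij_betw b {..<k} {0..<int k}"
    by (simp add: bij_betw_def)
  have sum_b: "(\<Sum>y\<in>{0..<int k}. f y) = (\<Sum>j<k. f (b j))" for f :: "int \<Rightarrow> real"
    by (rule sum.reindex_bij_betw[OF bij, symmetric])
  have near: "cycle_near k (b j) (b (Suc j))" "cycle_near k (b (Suc j)) (b j)" for j
  proof -
    have "[b j - b (Suc j) = (x + int j) - (x + int (Suc j))] (mod int k)"
      "[b (Suc j) - b j = (x + int (Suc j)) - (x + int j)] (mod int k)"
      unfolding b_def by (intro cong_diff; simp add: cong_def)+
    then show "cycle_near k (b j) (b (Suc j))" "cycle_near k (b (Suc j)) (b j)"
      by (auto simp: cycle_near_def)
  qed
  have b_0: "b 0 = x" "b k = x"
    using C by (auto simp: b_def)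
  have main: "2 * g x + (\<Sum>j<k. g (b j)) - g (b r') - g (b p') \<le> (\<Sum>j<k. h (b j))"
    if "0 < r'" "r' < p'" "p' < k" for r' p'
    using path_sum_ge[of "\<lambda>j. g (b j)" "\<lambda>j. h (b j)" r' p' k] that
      gh[OF b_mem b_mem] near by (auto simp: b_0 cycle_near_def)
  obtain r' where r': "b r' = r" "r' < k"
    using inv C(2) by blast
  obtain p' where p': "b p' = p" "p' < k"
    using inv C(3) by blast
  have ne: "r' \<noteq> 0" "p' \<noteq> 0" "r' \<noteq> p'"
    using distinct r' p' b_0 by (metis, metis, metis)
  then consider "r' < p'" | "p' < r'"
    by linarith
  then show ?thesis
    using main[of r' p'] main[of p' r'] r' p' \<open>r' \<noteq> 0\<close> \<open>p' \<noteq> 0\<close> unfolding sum_b by cases auto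
qed

text \<open>Choose \<open>x0\<close> with the largest density \<open>M\<close>, and \<open>p\<close>, \<open>r\<close> with the two smallest ones elsewhere; \<open>m\<close> is the
  larger of these two.  All densities that survive in \<open>cycle_sum_ge\<close> lie between \<open>m\<close> and \<open>M\<close>, so by concavity
  they may be split into these two levels, and \<open>real k * l\<close> is the resulting weight of the upper level.
  The two lost positions are counted at level \<open>m\<close>, which can only raise the mean.\<close>

lemma cycle_profile_ge:
  fixes a h :: "int \<Rightarrow> real"
  assumes k: "k \<ge> 3"
    and a: "\<And>x. x \<in> {0..<int k} \<Longrightarrow> 0 \<le> a x" "\<And>x. x \<in> {0..<int k} \<Longrightarrow> a x \<le> 1"
    and h: "\<And>x y. x \<in> {0..<int k} \<Longrightarrow> y \<in> {0..<int k} \<Longrightarrow> cycle_near k x y \<Longrightarrow>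
      profile (2 / real k) n (a x) \<le> h y"
  shows "real k * profile (2 / real k) (Suc n) ((\<Sum>x\<in>{0..<int k}. a x) / real k)
    \<le> (\<Sum>x\<in>{0..<int k}. h x)"
proof -
  define C where "C = {0..<int k}"
  define e where "e = 2 / real k"
  have e: "0 < e" "e < 1"
    using k by (auto simp: e_def)
  have C: "finite C" "card C = k"
    by (auto simp: C_def)
  have max_min: "\<exists>x\<in>S. \<forall>y\<in>S. a y \<le> a x" "\<exists>x\<in>S. \<forall>y\<in>S. a x \<le> a y"
    if S: "S \<subseteq> C" "card S > 0" for S
  proof -
    have "finite (a ` S)" "a ` S \<noteq> {}"
      using S by (auto simp: card_gt_0_iff)
    moreover from this have "Max (a ` S) \<in> a ` S" "Min (a ` S) \<in> a ` S"
      by (simp_all add: Max_in Min_in)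
    ultimately show "\<exists>x\<in>S. \<forall>y\<in>S. a y \<le> a x" "\<exists>x\<in>S. \<forall>y\<in>S. a x \<le> a y"
      by (auto simp del: Max_in Min_in) (metis Max_ge Min_le image_eqI)+
  qed
  obtain x0 where x0: "x0 \<in> C" "\<And>y. y \<in> C \<Longrightarrow> a y \<le> a x0"
    using max_min(1)[of C] C k by auto
  obtain p where p: "p \<in> C - {x0}" "\<And>y. y \<in> C - {x0} \<Longrightarrow> a p \<le> a y"
    using max_min(2)[of "C - {x0}"] C k x0 by auto
  have "card (C - {x0, p}) > 0"
    using card_Diff_subset[of "{x0, p}" C] C k p x0 by simp
  then obtain r where r: "r \<in> C - {x0, p}" "\<And>y. y \<in> C - {x0, p} \<Longrightarrow> a r \<le> a y"
    using max_min(2)[of "C - {x0, p}"] by blast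
  define M m where "M = a x0" and "m = a r"
  have mM: "0 \<le> m" "m \<le> M" "M \<le> 1"
    using a x0 r by (auto simp: M_def m_def C_def)
  define D where "D = C - {r, p}"
  have D: "finite D" "D \<subseteq> C" "x0 \<in> D"
    using C x0 p r by (auto simp: D_def)
  have card_D: "real (card D) = real k - 2"
    using card_Diff_subset[of "{r, p}" C] C k p r by (simp add: D_def)
  have sum_C: "(\<Sum>x\<in>C. f x) = (\<Sum>x\<in>D. f x) + f r + f p" for f :: "int \<Rightarrow> real"
    using sum.subset_diff[of "{r, p}" C f] C p r by (simp add: D_def)
  \<comment> \<open>If the levels coincide, the choice \<open>1\<close> keeps the weight of the upper level positive.\<close>
  define \<theta> where "\<theta> x = (if m = M then 1 else (a x - m) / (M - m))" for x
  have a_eq: "a x = (1 - \<theta> x) * m + \<theta> x * M" and \<theta>: "0 \<le> \<theta> x" "\<theta> x \<le> 1" if "x \<in> D" for x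
  proof -
    have ax: "m \<le> a x" "a x \<le> M"
      using that r(2)[of x] x0(2)[of x] mM by (auto simp: D_def m_def M_def)
    show "0 \<le> \<theta> x" "\<theta> x \<le> 1"
      using ax by (auto simp: \<theta>_def)
    show "a x = (1 - \<theta> x) * m + \<theta> x * M"
    proof (cases "m = M")
      case False
      then have "\<theta> x * (M - m) = a x - m"
        by (simp add: \<theta>_def)
      then show ?thesis
        by (simp add: algebra_simps)
    qed (use ax in \<open>simp add: \<theta>_def\<close>)
  qed
  define T where "T = (\<Sum>x\<in>D. \<theta> x)"
  define l where "l = T / real k"
  have "\<theta> x0 = 1"
    by (auto simp: \<theta>_def M_def)
  then have "T \<ge> 1"
    unfolding T_def using member_le_sum[of x0 D \<theta>] D \<theta> by auto
  moreover have "T \<le> real k - 2"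
    unfolding T_def card_D[symmetric] using sum_bounded_above[of D \<theta> 1] \<theta> by simp
  ultimately have l: "0 < l" "l + e \<le> 1"
    using k by (auto simp: l_def e_def field_simps)
  have mix: "(\<Sum>x\<in>D. (1 - \<theta> x) * u + \<theta> x * v) = T * v + (real k - 2 - T) * u" for u v
    unfolding card_D[symmetric]
    by (simp add: sum.distrib sum_distrib_right[symmetric] sum_subtractf T_def)
  have kl: "real k * l = T" "real k * e = 2"
    using k by (auto simp: l_def e_def)
  have density: "(\<Sum>x\<in>C. a x) / real k \<le> l * M + (1 - l) * m"
  proof -
    have "a p \<le> m"
      using p r by (auto simp: m_def)
    have "(\<Sum>x\<in>C. a x) \<le> T * M + (real k - T) * m"
    proof -
      have "(\<Sum>x\<in>D. a x) = T * M + (real k - 2 - T) * m"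
        unfolding mix[symmetric] by (intro sum.cong refl a_eq)
      then show ?thesis
        using \<open>a p \<le> m\<close> by (simp add: sum_C m_def algebra_simps)
    qed
    also have "\<dots> = real k * (l * M + (1 - l) * m)"
      unfolding kl(1)[symmetric] by (simp add: algebra_simps)
    finally show ?thesis
      using k by (simp add: pos_divide_le_eq mult.commute)
  qed
  have density_nonneg: "0 \<le> (\<Sum>x\<in>C. a x) / real k"
    using a by (auto simp: C_def intro!: divide_nonneg_nonneg sum_nonneg)
  have level_le_1: "l * M + (1 - l) * m \<le> 1"
    using convex_bound_le[of M 1 m l "1 - l"] mM l e by simp
  have "real k * profile e (Suc n) ((\<Sum>x\<in>C. a x) / real k)
      \<le> real k * profile e (Suc n) (l * M + (1 - l) * m)"
    using e density density_nonneg level_le_1 by (intro mult_left_mono profile_mono) auto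
  also have "\<dots> \<le> real k * ((l + e) * profile e n M + (1 - l - e) * profile e n m)"
    using e l mM by (intro mult_left_mono profile_two_level) auto
  also have "\<dots> = (real k * l + real k * e) * profile e n M
      + (real k - real k * l - real k * e) * profile e n m"
    by (simp add: algebra_simps)
  also have "\<dots> = 2 * profile e n M + (\<Sum>x\<in>D. (1 - \<theta> x) * profile e n m + \<theta> x * profile e n M)"
    unfolding mix kl by (simp add: algebra_simps)
  also have "\<dots> \<le> 2 * profile e n (a x0) + (\<Sum>x\<in>D. profile e n (a x))"
  proof -
    have "(1 - \<theta> x) * profile e n m + \<theta> x * profile e n M \<le> profile e n (a x)" if "x \<in> D" for x
      using concave_onD[OF concave_on_profile[of e n], of "\<theta> x" m M] a_eq[OF that] \<theta>[OF that] mM e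
      by simp
    then show ?thesis
      by (auto simp: M_def intro!: sum_mono)
  qed
  also have "\<dots> = 2 * profile e n (a x0) + (\<Sum>x\<in>C. profile e n (a x))
      - profile e n (a r) - profile e n (a p)"
    by (simp add: sum_C)
  also have "\<dots> \<le> (\<Sum>x\<in>C. h x)"
    unfolding C_def using x0 p r h by (intro cycle_sum_ge) (auto simp: C_def e_def)
  finally show ?thesis
    by (simp add: C_def e_def)
qed

section \<open>Neighbourhoods in the discrete torus\<close>

definition torus :: "nat \<Rightarrow> nat \<Rightarrow> (nat \<Rightarrow> int) set" where
  "torus k n = {1..n} \<rightarrow>\<^sub>E {0..<int k}"

definition torus_nbhd :: "nat \<Rightarrow> nat \<Rightarrow> (nat \<Rightarrow> int) set \<Rightarrow> (nat \<Rightarrow> int) set" where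
  "torus_nbhd k n A = {v \<in> torus k n. \<exists>u\<in>A. \<forall>i\<in>{1..n}. cycle_near k (u i) (v i)}"

definition slice :: "nat \<Rightarrow> nat \<Rightarrow> (nat \<Rightarrow> int) set \<Rightarrow> int \<Rightarrow> (nat \<Rightarrow> int) set" where
  "slice k n A x = {f \<in> torus k n. f(Suc n := x) \<in> A}"

lemma finite_torus: "finite (torus k n)"
  by (simp add: torus_def finite_PiE)

lemma card_torus: "card (torus k n) = k ^ n"
  by (simp add: torus_def card_PiE)

lemma pverts_strong_power: "pverts (strong_power (cycle_graph k) n) = torus k n"
  by (simp add: strong_power_def strong_product_def cycle_graph_def torus_def Let_def)

lemma closed_neighborhood_strong_power:
  assumes "A \<subseteq> torus k n"
  shows "closed_neighborhood (strong_power (cycle_graph k) n) A = torus_nbhd k n A"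
proof -
  have arcs: "(u, v) \<in> parcs (strong_power (cycle_graph k) n) \<longleftrightarrow>
      u \<in> torus k n \<and> v \<in> torus k n \<and> u \<noteq> v \<and> (\<forall>i\<in>{1..n}. cycle_near k (u i) (v i))" for u v
    by (fastforce simp: strong_power_def strong_product_def cycle_graph_def torus_def Let_def
        cycle_near_def dest: PiE_mem)
  show ?thesis
    using assms
    by (fastforce simp: closed_neighborhood_def pverts_strong_power arcs torus_nbhd_def cycle_near_def)
qed

lemma card_eq_sum_slices:
  assumes "A \<subseteq> torus k (Suc n)"
  shows "card A = (\<Sum>x\<in>{0..<int k}. card (slice k n A x))"
proof -
  let ?E = "\<lambda>x f. f(Suc n := x) :: nat \<Rightarrow> int"
  have "A = (\<Union>x\<in>{0..<int k}. ?E x ` slice k n A x)"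
  proof
    show "A \<subseteq> (\<Union>x\<in>{0..<int k}. ?E x ` slice k n A x)"
    proof
      fix f assume f: "f \<in> A"
      then have "f \<in> torus k (Suc n)"
        using assms by auto
      then have "f(Suc n := undefined) \<in> torus k n" "f (Suc n) \<in> {0..<int k}"
        by (auto simp: torus_def PiE_iff extensional_def)
      moreover have f_eq: "?E (f (Suc n)) (f(Suc n := undefined)) = f"
        by simp
      ultimately have "f(Suc n := undefined) \<in> slice k n A (f (Suc n))"
        using f by (simp add: slice_def)
      with f_eq have "f \<in> ?E (f (Suc n)) ` slice k n A (f (Suc n))"
        by (intro image_eqI) auto
      then show "f \<in> (\<Union>x\<in>{0..<int k}. ?E x ` slice k n A x)"
        using \<open>f (Suc n) \<in> {0..<int k}\<close> by blast
    qed
  qed (auto simp: slice_def)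
  moreover have "card (\<Union>x\<in>{0..<int k}. ?E x ` slice k n A x)
      = (\<Sum>x\<in>{0..<int k}. card (?E x ` slice k n A x))"
  proof (intro card_UN_disjoint ballI impI)
    fix x y :: int assume "x \<noteq> y"
    then show "?E x ` slice k n A x \<inter> ?E y ` slice k n A y = {}"
      by (auto dest: fun_cong[of _ _ "Suc n"])
  qed (auto simp: slice_def finite_torus)
  moreover have "card (?E x ` slice k n A x) = card (slice k n A x)" for x
  proof (intro card_image inj_onI)
    fix f g assume fg: "f \<in> slice k n A x" "g \<in> slice k n A x" and eq: "?E x f = ?E x g"
    then have "f (Suc n) = g (Suc n)"
      by (simp add: slice_def torus_def PiE_def extensional_def)
    then show "f = g"
      using eq by (metis fun_upd_idem_iff fun_upd_upd)
  qed
  ultimately show ?thesis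
    by simp
qed

lemma torus_nbhd_slice:
  assumes "cycle_near k x y" "y \<in> {0..<int k}"
  shows "torus_nbhd k n (slice k n A x) \<subseteq> slice k n (torus_nbhd k (Suc n) A) y"
proof
  fix v assume "v \<in> torus_nbhd k n (slice k n A x)"
  then obtain u where v: "v \<in> torus k n" and u: "u(Suc n := x) \<in> A"
    and near: "\<forall>i\<in>{1..n}. cycle_near k (u i) (v i)"
    by (auto simp: torus_nbhd_def slice_def)
  have "v(Suc n := y) \<in> torus k (Suc n)"
    using v assms(2) by (auto simp: torus_def PiE_iff extensional_def)
  moreover have "\<forall>i\<in>{1..Suc n}. cycle_near k ((u(Suc n := x)) i) ((v(Suc n := y)) i)"
    using near assms(1) by auto
  ultimately have "v(Suc n := y) \<in> torus_nbhd k (Suc n) A"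
    unfolding torus_nbhd_def using u by blast
  then show "v \<in> slice k n (torus_nbhd k (Suc n) A) y"
    using v by (simp add: slice_def)
qed

text \<open>The density of a slice of the neighbourhood of \<open>A\<close> is at least the profile of the densities of
  the equal or adjacent slices of \<open>A\<close>, so \<open>cycle_profile_ge\<close> provides the induction step.\<close>

theorem torus_isoperimetry:
  assumes k: "k \<ge> 3" and A: "A \<subseteq> torus k n"
  shows "real k ^ n * profile (2 / real k) n (real (card A) / real k ^ n) \<le> real (card (torus_nbhd k n A))"
  using A
proof (induction n arbitrary: A)
  case 0
  show ?case
  proof (cases "A = {}")
    case False
    then have "A = {\<lambda>_. undefined}"
      using 0 by (auto simp: torus_def)
    then have "torus_nbhd k 0 A = {\<lambda>_. undefined}"
      by (auto simp: torus_nbhd_def torus_def)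
    then show ?thesis
      by (simp add: profile_le_1)
  qed simp
next
  case (Suc n)
  define N where "N = torus_nbhd k (Suc n) A"
  define a h where "a x = real (card (slice k n A x)) / real k ^ n"
    and "h x = real (card (slice k n N x)) / real k ^ n" for x
  have kn: "real k ^ n > 0"
    using k by simp
  have sums: "(\<Sum>x\<in>{0..<int k}. a x) = real (card A) / real k ^ n"
    "(\<Sum>x\<in>{0..<int k}. h x) = real (card N) / real k ^ n"
    using card_eq_sum_slices[of A k n] card_eq_sum_slices[of N k n] Suc.prems
    by (auto simp: a_def h_def N_def torus_nbhd_def simp flip: sum_divide_distrib)
  have "real k * profile (2 / real k) (Suc n) ((\<Sum>x\<in>{0..<int k}. a x) / real k)
      \<le> (\<Sum>x\<in>{0..<int k}. h x)"
  proof (rule cycle_profile_ge[OF k])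
    fix x
    show "0 \<le> a x"
      by (simp add: a_def)
    have "card (slice k n A x) \<le> k ^ n"
      unfolding card_torus[symmetric] by (intro card_mono finite_torus) (auto simp: slice_def)
    then have "real (card (slice k n A x)) \<le> real k ^ n"
      by (metis of_nat_le_iff of_nat_power)
    then show "a x \<le> 1"
      using kn by (simp add: a_def)
  next
    fix x y assume y: "y \<in> {0..<int k}" and near: "cycle_near k x y"
    have "real k ^ n * profile (2 / real k) n (a x) \<le> real (card (torus_nbhd k n (slice k n A x)))"
      unfolding a_def by (intro Suc.IH) (auto simp: slice_def)
    also have "\<dots> \<le> real (card (slice k n N y))"
      unfolding N_def of_nat_le_iff using torus_nbhd_slice[OF near y]
      by (intro card_mono) (auto simp: slice_def intro: finite_subset[OF _ finite_torus])
    finally show "profile (2 / real k) n (a x) \<le> h y"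
      using kn by (simp add: h_def pos_le_divide_eq mult.commute)
  qed
  then have "real k ^ n * (real k * profile (2 / real k) (Suc n) (real (card A) / real k ^ Suc n)) \<le> card N"
    unfolding sums using kn by (simp add: pos_le_divide_eq mult_ac)
  then show ?case
    by (simp add: N_def mult_ac)
qed

text \<open>The profile estimates require \<open>e < 1\<close>, that is \<open>k \<ge> 3\<close>.  On a shorter cycle any two vertices
  are equal or adjacent.\<close>

lemma torus_nbhd_small:
  assumes "k \<le> 2" "A \<subseteq> torus k n" "A \<noteq> {}"
  shows "torus_nbhd k n A = torus k n"
proof -
  have near: "cycle_near k u v" if "u \<in> {0..<int k}" "v \<in> {0..<int k}" for u v
  proof -
    have "u - v = 0 \<or> u - v = 1 \<or> u - v = -1"
      using that assms by auto
    then show ?thesis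
      by (auto simp: cycle_near_def)
  qed
  obtain u where "u \<in> A"
    using assms by blast
  then have "\<forall>i\<in>{1..n}. cycle_near k (u i) (v i)" if "v \<in> torus k n" for v
    using that assms by (auto simp: torus_def intro!: near dest: PiE_mem)
  then show ?thesis
    using \<open>u \<in> A\<close> by (auto simp: torus_nbhd_def)
qed

theorem corollary1p3:
  fixes k n :: nat and A :: "(nat \<Rightarrow> int) set" and \<alpha> :: real
  assumes "k \<ge> 1" and "n \<ge> 1"
    and "A \<subseteq> pverts (strong_power (cycle_graph k) n)"
    and "A \<noteq> {}"
    and "real (card A) = \<alpha> * real k ^ n"
  shows "real (card (closed_neighborhood (strong_power (cycle_graph k) n) A)) \<ge>
    real k ^ n *
      Min (\<Union>t\<in>{1..n}. {1,
             (\<alpha> powr (1 / real t) + 2 / real k) ^ t,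
             1 - (max 0 ((1 - \<alpha>) powr (1 / real t) - 2 / real k)) ^ t})"
    (is "_ \<ge> _ * Min ?S")
proof -
  have A: "A \<subseteq> torus k n"
    using assms(3) by (simp add: pverts_strong_power)
  have nbhd: "closed_neighborhood (strong_power (cycle_graph k) n) A = torus_nbhd k n A"
    by (rule closed_neighborhood_strong_power[OF A])
  show ?thesis
  proof (cases "k \<ge> 3")
    case True
    have "card A > 0"
      using A assms(4) finite_subset[OF A finite_torus] by (simp add: card_gt_0_iff)
    then have "\<alpha> \<noteq> 0"
      using assms(5) by auto
    moreover have "?S = insert 1 (\<Union>t\<in>{1..n}. {cube_growth (2 / real k) t \<alpha>,
        1 - cube_shrink (2 / real k) t (1 - \<alpha>)})"
      using assms(2) by (auto simp: cube_growth_def cube_shrink_def)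
    ultimately have "Min ?S = profile (2 / real k) n \<alpha>"
      by (simp add: profile_def)
    moreover have "\<alpha> = real (card A) / real k ^ n"
      using assms(1,5) by simp
    ultimately show ?thesis
      using torus_isoperimetry[OF True A] nbhd by simp
  next
    case False
    have "1 \<in> ?S"
      using assms(2) by auto
    then have "Min ?S \<le> 1"
      by (intro Min_le) auto
    then have "real k ^ n * Min ?S \<le> real k ^ n * 1"
      by (intro mult_left_mono) auto
    also have "\<dots> = real (card (torus_nbhd k n A))"
      using torus_nbhd_small[of k A n] False A assms(4) by (simp add: card_torus)
    finally show ?thesis
      using nbhd by simp
  qed
qed

end
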